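(* Let $k$ be a field of characteristic $p > 0$ and let $S$ be a submonoid of a free Abelian group $M$ of finite rank. If the monoid algebra $k[S]$ is split-$F$-regular, then $k[S]$ is a finitely generated $k$-algebra. Equivalently, $S$ is a finitely generated monoid.
   Context: For a commutative ring $R$ of prime characteristic $p$ and an integer $e>0$, $F^e_*R$ denotes the ring $R$ viewed as an $R$-module by restriction of scalars along the $e$-th iterate $F^e\colon R\to R$, $r\mapsto r^{p^e}$, of Frobenius; the element of $F^e_*R$ corresponding to $x\in R$ is written $F^e_*x$, so that $r\cdot F^e_*x=F^e_*(r^{p^e}x)$. An integral domain $R$ of characteristic $p>0$ (not assumed Noetherian nor $F$-finite) is split-$F$-regular if for every $c\in R\setminus\{0\}$ there is an integer $e>0$ such that the unique $R$-linear map $R\to F^e_*R$ with $1\mapsto F^e_*c$ splits as a map of $R$-modules (i.e. there is an $R$-linear map $\phi\colon F^e_*R\to R$ with $\phi(F^e_*c)=1$). A submonoid of an Abelian group contains $0$. The monoid algebra $k[S]$ has $k$-basis $\{X^s: s\in S\}$ with $X^sX^t=X^{s+t}$. *)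

theory Defs
  imports
    "HOL-Algebra.Generated_Rings"
    "HOL-Algebra.Module"
    "HOL-Algebra.Multiplicative_Group"
    "HOL-Algebra.Free_Abelian_Groups"
    "HOL-Library.Poly_Mapping"
begin

text \<open>The field and the ambient abelian group are types (of class \<open>field\<close> and
  \<open>ab_group_add\<close>). The monoid algebra is a ring in the sense of HOL-Algebra, so that
  the notions concerning it are defined for arbitrary rings.\<close>

definition additive_monoid :: "'m::monoid_add set \<Rightarrow> 'm monoid" where
  "additive_monoid S = \<lparr>carrier = S, monoid.mult = (+), one = 0\<rparr>"

definition free_abelian_finite_rank :: "('m, 'b) monoid_scheme \<Rightarrow> bool" where
  "free_abelian_finite_rank M \<longleftrightarrow> (\<exists>n::nat. M \<cong> free_Abelian_group {..<n})"

definition finitely_generated_monoid :: "('m, 'b) monoid_scheme \<Rightarrow> bool" where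
  "finitely_generated_monoid N \<longleftrightarrow>
     (\<exists>G. finite G \<and> G \<subseteq> carrier N \<and> (\<lambda>T. submonoid T N) hull G = carrier N)"

text \<open>Multiplication on \<open>'m \<Rightarrow>\<^sub>0 'k\<close> is convolution, and \<open>Poly_Mapping.single s a\<close> is the
  element usually written \<open>a X\<^sup>s\<close>.\<close>

definition monoid_algebra :: "'m::comm_monoid_add set \<Rightarrow> ('m \<Rightarrow>\<^sub>0 'k::comm_ring_1) ring" where
  "monoid_algebra S =
     \<lparr>carrier = {f. Poly_Mapping.keys f \<subseteq> S}, monoid.mult = (*), one = 1, ring.zero = 0, ring.add = (+)\<rparr>"

lemma cring_monoid_algebra:
  fixes S :: "'m::ab_group_add set"
  assumes "submonoid S (additive_monoid UNIV)"
  shows "cring (monoid_algebra S :: ('m \<Rightarrow>\<^sub>0 'k::comm_ring_1) ring)"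
proof -
  have S: "0 \<in> S" "\<And>x y. x \<in> S \<Longrightarrow> y \<in> S \<Longrightarrow> x + y \<in> S"
    using submonoid.one_closed [OF assms] submonoid.m_closed [OF assms]
    by (auto simp: additive_monoid_def)
  have add: "Poly_Mapping.keys (f + g) \<subseteq> S"
    if "Poly_Mapping.keys f \<subseteq> S" "Poly_Mapping.keys g \<subseteq> S" for f g :: "'m \<Rightarrow>\<^sub>0 'k"
    using that Poly_Mapping.keys_add [of f g] by blast
  have mult: "Poly_Mapping.keys (f * g) \<subseteq> S"
    if "Poly_Mapping.keys f \<subseteq> S" "Poly_Mapping.keys g \<subseteq> S" for f g :: "'m \<Rightarrow>\<^sub>0 'k"
    using that keys_mult [of f g] S(2) by blast
  have one: "Poly_Mapping.keys (1 :: 'm \<Rightarrow>\<^sub>0 'k) \<subseteq> S"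
    using S(1) by (simp flip: single_one)
  have neg: "\<exists>y. Poly_Mapping.keys y \<subseteq> S \<and> y + x = 0"
    if "Poly_Mapping.keys x \<subseteq> S" for x :: "'m \<Rightarrow>\<^sub>0 'k"
    using that by (intro exI [of _ "- x"]) simp
  show ?thesis
    by (intro cringI abelian_groupI comm_monoidI)
      (use add mult one neg in \<open>auto simp: monoid_algebra_def algebra_simps\<close>)
qed

text \<open>An algebra structure is given by the image \<open>K\<close> of the base ring; the subalgebra
  generated by \<open>G\<close> is then the subring generated by \<open>K \<union> G\<close>.\<close>

definition finitely_generated_algebra :: "'a set \<Rightarrow> ('a, 'b) ring_scheme \<Rightarrow> bool" where
  "finitely_generated_algebra K R \<longleftrightarrow>
     (\<exists>G. finite G \<and> G \<subseteq> carrier R \<and> generate_ring R (K \<union> G) = carrier R)"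

text \<open>The order of an element is 0 if it has infinite order.\<close>

definition ring_char :: "('a, 'b) ring_scheme \<Rightarrow> nat" where
  "ring_char R = group.ord (add_monoid R) \<one>\<^bsub>R\<^esub>"

definition regular_module :: "('a, 'b) ring_scheme \<Rightarrow> ('a, 'a) module" where
  "regular_module R =
     \<lparr>carrier = carrier R, monoid.mult = monoid.mult R, one = \<one>\<^bsub>R\<^esub>, ring.zero = \<zero>\<^bsub>R\<^esub>, ring.add = ring.add R,
      smult = monoid.mult R\<rparr>"

definition frobenius_pushforward :: "nat \<Rightarrow> ('a, 'b) ring_scheme \<Rightarrow> ('a, 'a) module" where
  "frobenius_pushforward e R =
     \<lparr>carrier = carrier R, monoid.mult = monoid.mult R, one = \<one>\<^bsub>R\<^esub>, ring.zero = \<zero>\<^bsub>R\<^esub>, ring.add = ring.add R,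
      smult = (\<lambda>r x. (r [^]\<^bsub>R\<^esub> (ring_char R ^ e)) \<otimes>\<^bsub>R\<^esub> x)\<rparr>"

definition linear_maps ::
  "('r, 'b) ring_scheme \<Rightarrow> ('r, 'm, 'c) module_scheme \<Rightarrow> ('r, 'n, 'd) module_scheme
     \<Rightarrow> ('m \<Rightarrow> 'n) set" where
  "linear_maps R M N =
     {f \<in> hom (add_monoid M) (add_monoid N).
        \<forall>r\<in>carrier R. \<forall>x\<in>carrier M. f (r \<odot>\<^bsub>M\<^esub> x) = r \<odot>\<^bsub>N\<^esub> f x}"

definition splits ::
  "('r, 'b) ring_scheme \<Rightarrow> ('r, 'm, 'c) module_scheme \<Rightarrow> ('r, 'n, 'd) module_scheme
     \<Rightarrow> ('m \<Rightarrow> 'n) \<Rightarrow> bool" where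
  "splits R M N f \<longleftrightarrow> (\<exists>\<phi>\<in>linear_maps R N M. \<forall>x\<in>carrier M. \<phi> (f x) = x)"

text \<open>The unique linear map from \<open>R\<close> to a module with \<open>\<one> \<mapsto> c\<close> is \<open>r \<mapsto> r \<odot> c\<close>.\<close>

definition split_F_regular :: "('a, 'b) ring_scheme \<Rightarrow> bool" where
  "split_F_regular R \<longleftrightarrow>
     domain R \<and> ring_char R > 0 \<and>
     (\<forall>c\<in>carrier R - {\<zero>\<^bsub>R\<^esub>}. \<exists>e>0.
        splits R (regular_module R) (frobenius_pushforward e R)
          (\<lambda>r. r \<odot>\<^bsub>frobenius_pushforward e R\<^esub> c))"

end

theory Submission
  imports Defs
begin

text \<open>For \<open>s\<close> in \<open>S\<close>, a splitting \<open>\<phi>\<close> of the map sending 1 to \<open>X\<^sup>s\<close> gives \<open>q > 0\<close> such that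
  \<open>s + q u \<in> S\<close> implies \<open>u \<in> S\<close> for every \<open>u\<close> in the group generated by \<open>S\<close>. In particular
  \<open>S\<close> is saturated. Let that group be spanned by a finite subset \<open>B\<close> of \<open>S\<close>, and take for \<open>s\<close> the
  sum of \<open>B\<close>, which stays in the cone of \<open>S\<close> after any perturbation of its coordinates by at
  most 1. Hence every lattice point within \<open>1/q\<close> of the cone lies in \<open>S\<close>. By Dirichlet's
  pigeonhole argument, for every large \<open>x \<in> S\<close> some intermediate multiple \<open>\<lambda> x\<close> with \<open>0 < \<lambda> < 1\<close> is
  within \<open>1/q\<close> of a lattice point \<open>u\<close>, and then \<open>x - u\<close> is within \<open>1/q\<close> of \<open>(1 - \<lambda>) x\<close>. So both
  \<open>u\<close> and \<open>x - u\<close> lie in \<open>S\<close>, and they are smaller than \<open>x\<close>; thus the elements of bounded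
  size generate \<open>S\<close>.\<close>

section \<open>Subgroups of free abelian groups of finite rank\<close>

lemma submonoid_additive_iff:
  "submonoid T (additive_monoid U) \<longleftrightarrow>
     T \<subseteq> U \<and> 0 \<in> T \<and> (\<forall>x\<in>T. \<forall>y\<in>T. x + y \<in> T)"
  by (auto simp: additive_monoid_def submonoid_def)

lemma comm_group_additive:
  "comm_group (additive_monoid (UNIV :: 'm::ab_group_add set))"
proof -
  have "\<exists>y. y + x = 0" for x :: 'm
    by (rule exI [of _ "- x"]) simp
  then show ?thesis
    by (intro comm_groupI) (auto simp: additive_monoid_def algebra_simps)
qed

text \<open>Group powers supply multiples by negative integers too. As a module over the integers,
  an abelian group has subgroups as its \<open>subspace\<close>s and generated subgroups as its
  \<open>span\<close>s.\<close>

definition int_scale :: "int \<Rightarrow> 'm::ab_group_add \<Rightarrow> 'm" where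
  "int_scale n x = x [^]\<^bsub>additive_monoid UNIV\<^esub> n"

interpretation int_scale: Modules.module int_scale
proof -
  interpret comm_group "additive_monoid (UNIV :: 'a set)"
    by (rule comm_group_additive)
  have c: "x \<in> carrier (additive_monoid UNIV)" for x :: 'a
    by (simp add: additive_monoid_def)
  have m: "x \<otimes>\<^bsub>additive_monoid UNIV\<^esub> y = x + y" for x y :: 'a
    by (simp add: additive_monoid_def)
  show "Modules.module (int_scale :: int \<Rightarrow> 'a \<Rightarrow> 'a)"
  proof
    fix a b :: int and x y :: 'a
    show "int_scale a (x + y) = int_scale a x + int_scale a y"
      using int_pow_distrib [OF c c, of x y a] by (simp add: int_scale_def m)
    show "int_scale (a + b) x = int_scale a x + int_scale b x"
      using int_pow_mult [OF c, of x a b] by (simp add: int_scale_def m)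
    show "int_scale a (int_scale b x) = int_scale (a * b) x"
      using int_pow_pow [OF c, of x b a] by (simp add: int_scale_def mult.commute)
    show "int_scale 1 x = x"
      using int_pow_1 [OF c, of x] by (simp add: int_scale_def)
  qed
qed

lemma int_scale_hom:
  fixes f :: "'m::ab_group_add \<Rightarrow> int"
  assumes "\<And>x y. f (x + y) = f x + f y"
  shows "f (int_scale n x) = n * f x"
proof -
  interpret f: additive f
    by unfold_locales (rule assms)
  have nat: "f (int_scale (int k) x) = int k * f x" for k
    by (induction k) (simp_all add: int_scale.scale_left_distrib f.add f.zero algebra_simps)
  show ?thesis
    by (cases n rule: int_cases2) (simp_all add: nat f.minus)
qed

lemma int_scale_mem:
  assumes "submonoid S (additive_monoid UNIV)" "x \<in> S" "n \<ge> 0"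
  shows "int_scale n x \<in> S"
proof -
  have "int_scale (int k) x \<in> S" for k
    by (induction k)
      (use assms(1,2) in \<open>auto simp: submonoid_additive_iff int_scale.scale_left_distrib\<close>)
  from this [of "nat n"] show ?thesis
    using assms(3) by simp
qed

lemma sum_int_scale_mem:
  assumes S: "submonoid S (additive_monoid UNIV)"
    and "B \<subseteq> S" "\<And>i. i \<in> B \<Longrightarrow> c i \<ge> 0"
  shows "(\<Sum>i\<in>B. int_scale (c i) i) \<in> S"
  using assms(2,3)
proof (induction B rule: infinite_finite_induct)
  case (insert x F)
  then have "int_scale (c x) x \<in> S"
    by (intro int_scale_mem [OF S]) auto
  then show ?case
    using insert S by (auto simp: submonoid_additive_iff)
qed (use S in \<open>auto simp: submonoid_additive_iff\<close>)

text \<open>Induction on the number of coordinates, which together separate the elements of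
  \<open>H\<close> from 0. The last coordinate maps \<open>H\<close> onto a cyclic group of
  integers; a preimage of a generator, added to a spanning set of the kernel, spans
  \<open>H\<close>.\<close>

lemma subgroup_finitely_spanned:
  fixes f :: "nat \<Rightarrow> 'm::ab_group_add \<Rightarrow> int"
  assumes hom: "\<And>i x y. i < n \<Longrightarrow> f i (x + y) = f i x + f i y"
    and "int_scale.subspace H"
    and "\<And>x. x \<in> H \<Longrightarrow> \<forall>i<n. f i x = 0 \<Longrightarrow> x = 0"
  shows "\<exists>A. finite A \<and> A \<subseteq> H \<and> H \<subseteq> int_scale.span A"
  using assms
proof (induction n arbitrary: H)
  case 0
  then show ?case
    by (intro exI [of _ "{}"]) auto
next
  case (Suc n)
  have hom: "f n (x + y) = f n x + f n y" for x y
    using Suc.prems(1) by blast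
  interpret fn: additive "f n"
    by unfold_locales (rule hom)
  note H = Suc.prems(2)
  define K where "K = {x \<in> H. f n x = 0}"
  have K: "int_scale.subspace K"
    using H by (auto simp: int_scale.subspace_def K_def hom fn.zero int_scale_hom [OF hom])
  have "\<exists>A. finite A \<and> A \<subseteq> K \<and> K \<subseteq> int_scale.span A"
    by (rule Suc.IH [OF _ K]) (use Suc.prems in \<open>auto simp: K_def less_Suc_eq\<close>)
  then obtain A where A: "finite A" "A \<subseteq> K" "K \<subseteq> int_scale.span A"
    by blast
  show ?case
  proof (cases "\<exists>x\<in>H. f n x > 0")
    case False
    have "f n x = 0" if "x \<in> H" for x
      using False that int_scale.subspace_neg [OF H that] fn.minus [of x]
      by (metis linorder_neqE_linordered_idom neg_0_less_iff_less)
    then have "H = K"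
      by (auto simp: K_def)
    then show ?thesis
      using A by blast
  next
    case True
    \<comment> \<open>The least positive value of \<open>f n\<close> on \<open>H\<close> generates
      the image: a remainder modulo \<open>d\<close> is again a value on \<open>H\<close>, hence
      0.\<close>
    define d where "d = (LEAST k. \<exists>x\<in>H. f n x = int k \<and> k > 0)"
    have "\<exists>k. \<exists>x\<in>H. f n x = int k \<and> k > 0"
      using True by (metis zero_less_imp_eq_int)
    then have "\<exists>x\<in>H. f n x = int d \<and> d > 0"
      unfolding d_def by (rule LeastI_ex)
    then obtain h where h: "h \<in> H" "f n h = int d" "d > 0"
      by blast
    have le: "int d \<le> f n x" if "x \<in> H" "f n x > 0" for x
    proof -
      have "d \<le> nat (f n x)"
        unfolding d_def by (rule Least_le) (use that in auto)
      then show ?thesis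
        using that by linarith
    qed
    have "x \<in> int_scale.span (insert h A)" if x: "x \<in> H" for x
    proof -
      define y where "y = x - int_scale (f n x div int d) h"
      have y: "y \<in> H"
        unfolding y_def
        by (intro int_scale.subspace_diff [OF H] int_scale.subspace_scale [OF H] x h)
      have fy: "f n y = f n x mod int d"
        by (simp add: y_def fn.diff int_scale_hom [OF hom] h minus_div_mult_eq_mod)
      have "f n y = 0"
        using le [OF y] fy h(3) by (smt (verit) of_nat_0_less_iff pos_mod_bound pos_mod_sign)
      then have "y \<in> int_scale.span (insert h A)"
        using y A(3) int_scale.span_mono [of A "insert h A"] by (auto simp: K_def)
      moreover have "int_scale (f n x div int d) h \<in> int_scale.span (insert h A)"
        by (intro int_scale.span_scale int_scale.span_base) simp
      ultimately have "y + int_scale (f n x div int d) h \<in> int_scale.span (insert h A)"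
        by (rule int_scale.span_add)
      then show ?thesis
        by (simp add: y_def)
    qed
    then show ?thesis
      using A h by (intro exI [of _ "insert h A"]) (auto simp: K_def)
  qed
qed

lemma free_abelian_subgroup_finitely_spanned:
  fixes H :: "'m::ab_group_add set"
  assumes "free_abelian_finite_rank (additive_monoid (UNIV :: 'm set))"
    and "int_scale.subspace H"
  shows "\<exists>A. finite A \<and> A \<subseteq> H \<and> H \<subseteq> int_scale.span A"
proof -
  obtain n h where "h \<in> iso (additive_monoid (UNIV :: 'm set)) (free_Abelian_group {..<n::nat})"
    using assms(1) by (auto simp: free_abelian_finite_rank_def is_iso_def)
  then have add: "\<And>x y. h (x + y) = h x + h y" and inj: "inj h"
    and keys: "\<And>x. Poly_Mapping.keys (h x) \<subseteq> {..<n}"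
    by (auto simp: iso_def bij_betw_def hom_def additive_monoid_def free_Abelian_group_def
        Pi_def)
  interpret h: additive h
    by unfold_locales (rule add)
  have "x = 0" if "\<forall>i<n. Poly_Mapping.lookup (h x) i = 0" for x
  proof -
    have "h x = 0"
      using that keys [of x] by (intro poly_mapping_eqI) (auto simp: in_keys_iff)
    then show ?thesis
      using inj h.zero by (metis injD)
  qed
  then show ?thesis
    using subgroup_finitely_spanned [of n "\<lambda>i x. Poly_Mapping.lookup (h x) i" H] assms(2)
    by (simp add: add lookup_add)
qed

text \<open>A finite spanning set of the group need not lie in \<open>S\<close>, but each of its
  members is a combination of finitely many elements of \<open>S\<close>; \<open>B\<close> collects
  these. Having \<open>B\<close> inside \<open>S\<close> later puts nonnegative combinations of
  \<open>B\<close> into \<open>S\<close>.\<close>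

lemma difference_group_finitely_spanned:
  fixes S :: "'m::ab_group_add set"
  assumes M: "free_abelian_finite_rank (additive_monoid (UNIV :: 'm set))"
  shows "\<exists>B. finite B \<and> B \<subseteq> S \<and> int_scale.span B = int_scale.span S"
proof -
  obtain A where A: "finite A" "A \<subseteq> int_scale.span S"
    "int_scale.span S \<subseteq> int_scale.span A"
    using free_abelian_subgroup_finitely_spanned [OF M int_scale.subspace_span [of S]] by blast
  have "\<exists>C. finite C \<and> C \<subseteq> S \<and> a \<in> int_scale.span C" if "a \<in> int_scale.span S" for a
  proof -
    obtain t r where "finite t" "t \<subseteq> S" "a = (\<Sum>v\<in>t. int_scale (r v) v)"
      using \<open>a \<in> int_scale.span S\<close> unfolding int_scale.span_explicit by blast
    then have "a \<in> int_scale.span t"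
      by (auto intro!: int_scale.span_sum int_scale.span_scale intro: int_scale.span_base)
    then show ?thesis
      using \<open>finite t\<close> \<open>t \<subseteq> S\<close> by blast
  qed
  then obtain C where C: "\<And>a. a \<in> A \<Longrightarrow> finite (C a) \<and> C a \<subseteq> S \<and> a \<in> int_scale.span (C a)"
    using A(2) by (metis subsetD)
  define B where "B = (\<Union>a\<in>A. C a)"
  have "A \<subseteq> int_scale.span B"
    using C int_scale.span_mono [of "C _" B] by (fastforce simp: B_def)
  then have "int_scale.span A \<subseteq> int_scale.span B"
    by (simp add: int_scale.span_minimal)
  moreover have "int_scale.span B \<subseteq> int_scale.span S"
    by (intro int_scale.span_mono) (use C in \<open>auto simp: B_def\<close>)
  ultimately show ?thesis
    using A C unfolding B_def by (intro exI [of _ "\<Union>a\<in>A. C a"]) blast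
qed

text \<open>In an integer combination of elements of \<open>S\<close>, the terms with negative
  coefficients are moved, with sign reversed, into the subtrahend.\<close>

lemma span_submonoid_eq_diff:
  assumes S: "submonoid S (additive_monoid UNIV)" and "u \<in> int_scale.span S"
  shows "\<exists>a\<in>S. \<exists>b\<in>S. u = a - b"
  using assms(2)
proof (induction rule: int_scale.span_induct_alt)
  case base
  show ?case
    using S by (force simp: submonoid_additive_iff)
next
  case (step n x y)
  then obtain a b where ab: "a \<in> S" "b \<in> S" "y = a - b"
    by blast
  show ?case
  proof (cases "n \<ge> 0")
    case True
    then have "int_scale n x + a \<in> S"
      using S ab int_scale_mem [OF S step(1)] by (auto simp: submonoid_additive_iff)
    then show ?thesis
      using ab by (metis add_diff_eq)
  next
    case False
    then have "int_scale (- n) x + b \<in> S"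
      using S ab int_scale_mem [OF S step(1), of "- n"] by (auto simp: submonoid_additive_iff)
    moreover have "int_scale n x + y = a - (int_scale (- n) x + b)"
      using ab by (simp add: algebra_simps)
    ultimately show ?thesis
      using ab by blast
  qed
qed

section \<open>Diophantine approximation\<close>

text \<open>With \<open>t = q ^ card B + 1\<close>, the bound says that \<open>u i\<close> is within
  \<open>1 / q\<close> of \<open>(j / t) * c i\<close>. The \<open>t\<close> multiples of
  \<open>c / t\<close>, taken modulo 1, fall into \<open>t - 1\<close> boxes of side
  \<open>1 / q\<close>; \<open>j\<close> is the difference of two indices sharing a box.\<close>

lemma simultaneous_approximation:
  fixes c :: "'i \<Rightarrow> int" and q :: int
  assumes B: "finite B" and q: "q > 0"
  shows "\<exists>j u. 0 < j \<and> j < q ^ card B + 1 \<and>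
    (\<forall>i\<in>B. q * \<bar>(q ^ card B + 1) * u i - j * c i\<bar> \<le> q ^ card B + 1)"
proof -
  define t where "t = q ^ card B + 1"
  have t: "t > 0"
    using q by (simp add: t_def add_pos_pos)
  \<comment> \<open>The fractional parts of the \<open>a c i / t\<close>, rounded down to multiples of \<open>1 / q\<close>.\<close>
  define box where "box a = (\<lambda>i\<in>B. q * ((a * c i) mod t) div t)" for a
  have "q * (x mod t) div t \<in> {0..<q}" for x
  proof -
    have "q * (x mod t) < q * t"
      using q t by simp
    moreover have "q * (x mod t) div t * t \<le> q * (x mod t)"
      using t by (simp add: minus_mod_eq_div_mult [symmetric])
    ultimately have "q * (x mod t) div t * t < q * t"
      by linarith
    then have "q * (x mod t) div t < q"
      using t by simp
    then show ?thesis
      using q t by (simp add: pos_imp_zdiv_nonneg_iff)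
  qed
  then have "box ` {0..<t} \<subseteq> B \<rightarrow>\<^sub>E {0..<q}"
    by (auto simp: box_def)
  moreover have "card (B \<rightarrow>\<^sub>E {0..<q}) = nat q ^ card B"
    using B by (simp add: card_PiE)
  moreover have "card {0..<t} = nat q ^ card B + 1"
    using q by (simp add: t_def nat_add_distrib nat_power_eq)
  ultimately have "\<not> inj_on box {0..<t}"
    using B by (metis card_inj_on_le finite_PiE finite_atLeastLessThan_int add_le_same_cancel1
        not_one_le_zero)
  then obtain a b where ab: "0 \<le> a" "a < b" "b < t" "box a = box b"
    unfolding inj_on_def by (metis atLeastLessThan_iff linorder_neqE_linordered_idom)
  \<comment> \<open>The witness \<open>u\<close> is the difference of the integer parts of the two
    multiples, so the error is the difference of their fractional parts, which lie in the same
    box.\<close>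
  have "q * \<bar>t * (b * c i div t - a * c i div t) - (b - a) * c i\<bar> \<le> t" if "i \<in> B" for i
  proof -
    define r where "r x = x * c i mod t" for x
    have "q * r a div t = q * r b div t"
      using fun_cong [OF ab(4), of i] that by (simp add: box_def r_def)
    then have "q * r b - q * r a = (q * r b) mod t - (q * r a) mod t"
      by (metis (no_types, opaque_lifting) minus_mult_div_eq_mod add_diff_cancel_right' diff_diff_eq2
          diff_add_eq right_diff_distrib diff_right_commute)
    moreover have "(q * r b) mod t < t" "(q * r a) mod t < t" "(q * r b) mod t \<ge> 0"
      "(q * r a) mod t \<ge> 0"
      using t by simp_all
    ultimately have "\<bar>q * r b - q * r a\<bar> \<le> t"
      by linarith
    moreover have "t * (b * c i div t - a * c i div t) - (b - a) * c i = - (r b - r a)"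
      by (simp add: r_def algebra_simps minus_mult_div_eq_mod [symmetric])
    moreover have "q * \<bar>- (r b - r a)\<bar> = \<bar>q * r b - q * r a\<bar>"
      using q by (simp only: abs_minus_cancel right_diff_distrib [symmetric] abs_mult)
    ultimately show ?thesis
      by simp
  qed
  then show ?thesis
    unfolding t_def [symmetric]
    using ab by (intro exI [of _ "b - a"] exI [of _ "\<lambda>i. b * c i div t - a * c i div t"]) auto
qed

section \<open>Asymptotically closed monoids\<close>

text \<open>This is the trace on exponents of the splittings for the monomials
  \<open>X\<^sup>s\<close>, where \<open>q\<close> is a power of the characteristic. After division
  by \<open>q\<close>: a lattice point that the small shift \<open>s / q\<close> brings into
  \<open>(1 / q) S\<close> is already in \<open>S\<close>.\<close>

definition asymptotically_closed :: "'m::ab_group_add set \<Rightarrow> bool" where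
  "asymptotically_closed S \<longleftrightarrow>
     (\<forall>s\<in>S. \<exists>q>0. \<forall>u\<in>int_scale.span S. s + int_scale q u \<in> S \<longrightarrow> u \<in> S)"

lemma asymptotically_closedD:
  assumes "asymptotically_closed S" "s \<in> S"
  obtains q where "q > 0" "\<And>u. u \<in> int_scale.span S \<Longrightarrow> s + int_scale q u \<in> S \<Longrightarrow> u \<in> S"
  using assms unfolding asymptotically_closed_def by blast

text \<open>For \<open>u = a - b\<close>, the closure condition is applied at
  \<open>s = n b\<close>, a shift that works whatever \<open>q\<close> the condition
  returns.\<close>

lemma asymptotically_closed_imp_saturated:
  assumes S: "submonoid S (additive_monoid UNIV)"
    and closed: "asymptotically_closed S"
    and u: "u \<in> int_scale.span S" and n: "n > 0" "int_scale n u \<in> S"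
  shows "u \<in> S"
proof -
  obtain a b where ab: "a \<in> S" "b \<in> S" "u = a - b"
    using span_submonoid_eq_diff [OF S u] by blast
  have "int_scale n b \<in> S"
    using int_scale_mem [OF S ab(2)] n by simp
  then obtain q where q: "q > 0"
    and red: "\<And>u. u \<in> int_scale.span S \<Longrightarrow> int_scale n b + int_scale q u \<in> S \<Longrightarrow> u \<in> S"
    using asymptotically_closedD [OF closed] by blast
  \<comment> \<open>Since \<open>n u \<in> S\<close>, the element \<open>n b\<close> is a common denominator of all multiples of \<open>u\<close>.\<close>
  define k r where "k = q div n" and "r = q mod n"
  have kr: "q = k * n + r" "k \<ge> 0" "0 \<le> r" "r \<le> n"
    using n q by (auto simp: k_def r_def pos_imp_zdiv_nonneg_iff less_imp_le)
  \<comment> \<open>For \<open>q = k n + r\<close>, the part \<open>k n u\<close> is a multiple of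
    \<open>n u\<close>, and \<open>n b + r u = (n - r) b + r a\<close> has nonnegative
    coefficients.\<close>
  have "int_scale n b + int_scale q u =
      int_scale k (int_scale n u) + (int_scale (n - r) b + int_scale r a)"
    by (simp add: kr(1) int_scale.scale_left_distrib int_scale.scale_left_diff_distrib
        int_scale.scale_right_diff_distrib ab(3) algebra_simps)
  also have "\<dots> \<in> S"
  proof -
    have add: "\<And>x y. x \<in> S \<Longrightarrow> y \<in> S \<Longrightarrow> x + y \<in> S"
      using S by (simp add: submonoid_additive_iff)
    show ?thesis
      by (intro add int_scale_mem [OF S] n(2) ab kr) (use kr in simp)
  qed
  finally show ?thesis
    by (rule red [OF u])
qed

text \<open>As \<open>B\<close> spans but may be dependent, the descent runs over coordinate vectors
  \<open>c\<close>, with \<open>lin c\<close> the element represented; size means the maximum of the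
  \<open>\<bar>c i\<bar>\<close>.\<close>

lemma asymptotically_closed_imp_finitely_generated:
  fixes S :: "'m::ab_group_add set"
  assumes S: "submonoid S (additive_monoid UNIV)"
    and closed: "asymptotically_closed S"
    and B: "finite B" "B \<subseteq> S" "int_scale.span B = int_scale.span S"
  shows "finitely_generated_monoid (additive_monoid S)"
proof -
  define lin where "lin c = (\<Sum>i\<in>B. int_scale (c i) i)" for c :: "'m \<Rightarrow> int"
  have lin_add: "lin (\<lambda>i. c i + d i) = lin c + lin d" for c d
    by (simp add: lin_def int_scale.scale_left_distrib sum.distrib)
  have lin_scale: "lin (\<lambda>i. n * c i) = int_scale n (lin c)" for n c
    by (simp add: lin_def int_scale.scale_sum_right)
  have lin_nonneg: "lin c \<in> S" if "\<And>i. i \<in> B \<Longrightarrow> c i \<ge> 0" for c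
    unfolding lin_def by (rule sum_int_scale_mem [OF S B(2) that])
  have lin_span: "lin c \<in> int_scale.span S" for c
    unfolding B(3) [symmetric] lin_def
    by (intro int_scale.span_sum int_scale.span_scale int_scale.span_base)
  have range_lin: "x \<in> range lin" if "x \<in> S" for x
    using int_scale.span_base [OF that]
    unfolding B(3) [symmetric] int_scale.span_finite [OF B(1)] lin_def .
  \<comment> \<open>The closure condition is taken at the sum of \<open>B\<close>: its coordinates 1
    offset errors of up to \<open>1 / q\<close> in the coordinates of \<open>u\<close>, once these
    are multiplied by \<open>q\<close>.\<close>
  obtain q where q: "q > 0"
    and red: "\<And>u. u \<in> int_scale.span S \<Longrightarrow> lin (\<lambda>_. 1) + int_scale q u \<in> S \<Longrightarrow> u \<in> S"
    using asymptotically_closedD [OF closed lin_nonneg [of "\<lambda>_. 1"]] by auto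
  define t where "t = q ^ card B + 1"
  have t: "t > 0"
    using q by (simp add: t_def add_pos_pos)
  \<comment> \<open>If \<open>u\<close> is within \<open>1 / q\<close> of \<open>(j / t) c\<close>, then \<open>t (\<Sum>B + q u)\<close> is \<open>q j c\<close> plus a vector with
    nonnegative coordinates.\<close>
  have near: "lin u \<in> S"
    if "lin c \<in> S" "j \<ge> 0" and close: "\<And>i. i \<in> B \<Longrightarrow> q * \<bar>t * u i - j * c i\<bar> \<le> t" for c u j
  proof -
    have "t + q * (t * u i - j * c i) \<ge> 0" if "i \<in> B" for i
    proof -
      have "\<bar>q * (t * u i - j * c i)\<bar> \<le> t"
        using close [OF that] q by (simp add: abs_mult)
      then show ?thesis
        by linarith
    qed
    then have "lin (\<lambda>i. t + q * (t * u i - j * c i)) \<in> S"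
      by (rule lin_nonneg)
    moreover have "int_scale (q * j) (lin c) \<in> S"
      using int_scale_mem [OF S that(1)] that(2) q by simp
    ultimately have "lin (\<lambda>i. t + q * (t * u i - j * c i)) + lin (\<lambda>i. q * j * c i) \<in> S"
      using S by (simp only: lin_scale) (simp add: submonoid_additive_iff)
    also have "lin (\<lambda>i. t + q * (t * u i - j * c i)) + lin (\<lambda>i. q * j * c i) =
        lin (\<lambda>i. t * (1 + q * u i))"
      unfolding lin_add [symmetric] by (simp add: algebra_simps)
    finally have "int_scale t (lin (\<lambda>i. 1 + q * u i)) \<in> S"
      by (simp add: lin_scale)
    \<comment> \<open>Saturation cancels the factor \<open>t\<close>; afterwards the closure
      condition removes the shift and \<open>q\<close>.\<close>
    then have "lin (\<lambda>i. 1 + q * u i) \<in> S"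
      using asymptotically_closed_imp_saturated [OF S closed lin_span t] by blast
    then have "lin (\<lambda>_. 1) + int_scale q (lin u) \<in> S"
      by (simp add: lin_add lin_scale)
    then show ?thesis
      by (rule red [OF lin_span])
  qed
  \<comment> \<open>The vectors \<open>u\<close> and \<open>c - u\<close> approximate the fractions
    \<open>j / t\<close> and \<open>(t - j) / t\<close> of \<open>c\<close> with the same error, so
    \<open>near\<close> applies to both.\<close>
  have split: "\<exists>u. lin u \<in> S \<and> lin (\<lambda>i. c i - u i) \<in> S \<and>
      (\<forall>i\<in>B. \<bar>u i\<bar> < N \<and> \<bar>c i - u i\<bar> < N)"
    if c: "lin c \<in> S" and N: "N > t" "\<And>i. i \<in> B \<Longrightarrow> \<bar>c i\<bar> \<le> N" for c N
  proof -
    obtain j u where j: "0 < j" "j < t"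
      and u: "\<And>i. i \<in> B \<Longrightarrow> q * \<bar>t * u i - j * c i\<bar> \<le> t"
      using simultaneous_approximation [OF B(1) q, of c] unfolding t_def by blast
    have u': "q * \<bar>t * (c i - u i) - (t - j) * c i\<bar> \<le> t" if "i \<in> B" for i
    proof -
      have "t * (c i - u i) - (t - j) * c i = - (t * u i - j * c i)"
        by (simp add: algebra_simps)
      then show ?thesis
        using u [OF that] by (simp only: abs_minus_cancel)
    qed
    \<comment> \<open>Each fraction is at most \<open>(t - 1) / t\<close>, and the error is at most
      1 because \<open>q \<ge> 1\<close>. The resulting bound \<open>(t - 1) * N + t\<close> is
      below \<open>t * N\<close> exactly when \<open>N > t\<close>.\<close>
    have small: "\<bar>v\<bar> < N" if "0 \<le> l" "l < t" "\<bar>x\<bar> \<le> N" "q * \<bar>t * v - l * x\<bar> \<le> t" for l v x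
    proof -
      have "1 * \<bar>t * v - l * x\<bar> \<le> q * \<bar>t * v - l * x\<bar>"
        using q by (intro mult_right_mono) auto
      then have "\<bar>t * v - l * x\<bar> \<le> t"
        unfolding mult_1 using that(4) by (rule order_trans)
      moreover have "\<bar>l * x\<bar> \<le> (t - 1) * N"
        unfolding abs_mult by (rule mult_mono) (use that(1-3) t in linarith)+
      ultimately have "\<bar>t * v\<bar> \<le> (t - 1) * N + t"
        by linarith
      also have "\<dots> < t * N"
        using N by (simp add: algebra_simps)
      finally show ?thesis
        using t by (simp add: abs_mult)
    qed
    show ?thesis
      using near [OF c _ u] near [OF c _ u'] j small [OF _ _ N(2) u] small [OF _ _ N(2) u']
      by (intro exI [of _ u]) auto
  qed
  \<comment> \<open>The threshold \<open>t\<close> is where splitting stops: any larger bound on the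
    coordinates can be lowered by \<open>split\<close>.\<close>
  define G where "G = {lin c |c. lin c \<in> S \<and> (\<forall>i\<in>B. \<bar>c i\<bar> \<le> t)}"
  have "G \<subseteq> lin ` (B \<rightarrow>\<^sub>E {-t..t})"
  proof
    fix x assume "x \<in> G"
    then obtain c where c: "x = lin c" "\<forall>i\<in>B. \<bar>c i\<bar> \<le> t"
      by (auto simp: G_def)
    then have "restrict c B \<in> B \<rightarrow>\<^sub>E {-t..t}"
      by (force simp: abs_le_iff)
    moreover have "x = lin (restrict c B)"
      by (simp add: c lin_def)
    ultimately show "x \<in> lin ` (B \<rightarrow>\<^sub>E {-t..t})"
      by blast
  qed
  then have "finite G"
    using B(1) by (meson finite_PiE finite_atLeastAtMost_int finite_imageI finite_subset)
  moreover have "G \<subseteq> S"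
    by (auto simp: G_def)
  moreover have "S \<subseteq> T" if T: "submonoid T (additive_monoid S)" "G \<subseteq> T" for T
  proof -
    \<comment> \<open>Induction on the excess of the coordinate bound over \<open>t\<close>.
      Coordinates are integers, so the strict bound from \<open>split\<close> with
      \<open>N = t + n + 1\<close> becomes \<open>t + n\<close>.\<close>
    have "lin c \<in> T" if "lin c \<in> S" "\<And>i. i \<in> B \<Longrightarrow> \<bar>c i\<bar> \<le> t + int n" for c n
      using that
    proof (induction n arbitrary: c)
      case 0
      then show ?case
        using T by (auto simp: G_def)
    next
      case (Suc n)
      then obtain u where u: "lin u \<in> S" "lin (\<lambda>i. c i - u i) \<in> S"
        "\<And>i. i \<in> B \<Longrightarrow> \<bar>u i\<bar> < t + int (Suc n) \<and> \<bar>c i - u i\<bar> < t + int (Suc n)"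
        using split [of c "t + int (Suc n)"] by auto
      have "lin u \<in> T" "lin (\<lambda>i. c i - u i) \<in> T"
        using u by (auto intro!: Suc.IH simp: less_le_not_le) force+
      then have "lin u + lin (\<lambda>i. c i - u i) \<in> T"
        using T by (auto simp: submonoid_additive_iff)
      then show ?case
        by (simp flip: lin_add)
    qed
    moreover have "\<exists>n. \<forall>i\<in>B. \<bar>c i\<bar> \<le> t + int n" for c :: "'m \<Rightarrow> int"
    proof -
      have "\<bar>c i\<bar> \<le> (\<Sum>i\<in>B. \<bar>c i\<bar>)" if "i \<in> B" for i
        using B(1) that by (intro member_le_sum) auto
      then show ?thesis
        using t by (intro exI [of _ "nat (\<Sum>i\<in>B. \<bar>c i\<bar>)"]) force
    qed
    ultimately show ?thesis
      using range_lin by (metis imageE subsetI)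
  qed
  moreover have "submonoid S (additive_monoid S)"
    using S by (auto simp: submonoid_additive_iff)
  ultimately show ?thesis
    unfolding finitely_generated_monoid_def hull_def
    by (intro exI [of _ G]) (auto simp: additive_monoid_def)
qed

section \<open>Monoid algebras\<close>

lemma monoid_algebra_simps [simp]:
  "carrier (monoid_algebra S) = {f. Poly_Mapping.keys f \<subseteq> S}"
  "f \<otimes>\<^bsub>monoid_algebra S\<^esub> g = f * g"
  "\<one>\<^bsub>monoid_algebra S\<^esub> = 1"
  "f \<oplus>\<^bsub>monoid_algebra S\<^esub> g = f + g"
  "\<zero>\<^bsub>monoid_algebra S\<^esub> = 0"
  by (simp_all add: monoid_algebra_def)

lemma a_inv_monoid_algebra:
  fixes f :: "'m::ab_group_add \<Rightarrow>\<^sub>0 'k::comm_ring_1"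
  assumes "submonoid S (additive_monoid UNIV)" "Poly_Mapping.keys f \<subseteq> S"
  shows "\<ominus>\<^bsub>monoid_algebra S\<^esub> f = - f"
proof -
  interpret cring "monoid_algebra S :: ('m \<Rightarrow>\<^sub>0 'k) ring"
    by (rule cring_monoid_algebra [OF assms(1)])
  show ?thesis
    by (rule minus_equality) (use assms(2) in auto)
qed

lemma single_pow_monoid_algebra:
  fixes a :: "'m::ab_group_add"
  shows "Poly_Mapping.single a (1::'k::comm_ring_1) [^]\<^bsub>monoid_algebra S\<^esub> (n::nat) =
    Poly_Mapping.single (int_scale (int n) a) 1"
  by (induction n)
    (simp_all add: mult_single int_scale.scale_left_distrib add.commute flip: single_one)

text \<open>A splitting \<phi> of the map sending 1 to \<open>X\<^sup>s\<close> must send the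
  monomial with exponent \<open>s + q u\<close> to \<open>X\<^sup>u\<close>. Its values have
  exponents in \<open>S\<close>, so \<open>u \<in> S\<close>.\<close>

lemma split_F_regular_imp_asymptotically_closed:
  fixes S :: "'m::ab_group_add set"
  assumes S: "submonoid S (additive_monoid UNIV)"
    and reg: "split_F_regular (monoid_algebra S :: ('m \<Rightarrow>\<^sub>0 'k::field) ring)"
  shows "asymptotically_closed S"
  unfolding asymptotically_closed_def
proof
  fix s assume s: "s \<in> S"
  let ?R = "monoid_algebra S :: ('m \<Rightarrow>\<^sub>0 'k) ring"
  let ?X = "\<lambda>m. Poly_Mapping.single m (1::'k)"
  have "?X s \<noteq> 0"
    by (metis lookup_single_eq lookup_zero zero_neq_one)
  then have "?X s \<in> carrier ?R - {\<zero>\<^bsub>?R\<^esub>}"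
    using s by simp
  then obtain e where
    "splits ?R (regular_module ?R) (frobenius_pushforward e ?R)
      (\<lambda>r. r \<odot>\<^bsub>frobenius_pushforward e ?R\<^esub> ?X s)" and char: "ring_char ?R > 0"
    using reg unfolding split_F_regular_def by blast
  then obtain \<phi> where
    phi: "\<phi> \<in> linear_maps ?R (frobenius_pushforward e ?R) (regular_module ?R)"
    and split: "\<And>f. f \<in> carrier ?R \<Longrightarrow> \<phi> (f \<odot>\<^bsub>frobenius_pushforward e ?R\<^esub> ?X s) = f"
    unfolding splits_def by (auto simp: regular_module_def)
  define q where "q = ring_char ?R ^ e"
  have X_mem: "?X a \<in> carrier ?R" if "a \<in> S" for a
    using that by simp
  have shift: "?X a \<odot>\<^bsub>frobenius_pushforward e ?R\<^esub> ?X b = ?X (int_scale (int q) a + b)" for a b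
    by (simp add: frobenius_pushforward_def q_def single_pow_monoid_algebra mult_single)
  have "u \<in> S"
    if u: "u \<in> int_scale.span S" "s + int_scale (int q) u \<in> S" for u
  proof -
    obtain a b where ab: "a \<in> S" "b \<in> S" "u = a - b"
      using span_submonoid_eq_diff [OF S u(1)] by blast
    \<comment> \<open>Linearity gives \<open>X\<^sup>b \<phi>(X\<^sup>t) = X\<^sup>a\<close>, and \<open>X\<^sup>b\<close> is invertible in the group algebra.\<close>
    let ?t = "s + int_scale (int q) u"
    have "?X b * \<phi> (?X ?t) = \<phi> (?X b \<odot>\<^bsub>frobenius_pushforward e ?R\<^esub> ?X ?t)"
      using phi X_mem [OF ab(2)] X_mem [OF u(2)]
      unfolding linear_maps_def by (simp add: regular_module_def frobenius_pushforward_def)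
    also have "\<dots> = \<phi> (?X a \<odot>\<^bsub>frobenius_pushforward e ?R\<^esub> ?X s)"
      unfolding shift ab(3) by (simp add: int_scale.scale_right_diff_distrib algebra_simps)
    also have "\<dots> = ?X a"
      by (rule split [OF X_mem [OF ab(1)]])
    finally have "?X (- b) * (?X b * \<phi> (?X ?t)) = ?X (- b) * ?X a"
      by simp
    then have "\<phi> (?X ?t) = ?X u"
      by (simp add: mult_single ab(3) flip: mult.assoc)
    moreover have "\<phi> (?X ?t) \<in> carrier ?R"
      using phi X_mem [OF u(2)]
      by (auto simp: linear_maps_def hom_def regular_module_def frobenius_pushforward_def)
    ultimately show ?thesis
      by simp
  qed
  moreover have "int q > 0"
    using char by (simp add: q_def)
  ultimately show "\<exists>q>0. \<forall>u\<in>int_scale.span S. s + int_scale q u \<in> S \<longrightarrow> u \<in> S"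
    by blast
qed

text \<open>The exponents occurring in the algebra generators generate \<open>S\<close>: the
  elements with all exponents in a submonoid \<open>T\<close> form a subring, and if it contains the
  generators and constants, it contains every \<open>X\<^sup>s\<close> with
  \<open>s \<in> S\<close>.\<close>

lemma finitely_generated_algebra_imp_monoid:
  fixes S :: "'m::ab_group_add set"
  assumes S: "submonoid S (additive_monoid UNIV)"
    and fg: "finitely_generated_algebra (range (Poly_Mapping.single 0))
      (monoid_algebra S :: ('m \<Rightarrow>\<^sub>0 'k::field) ring)"
  shows "finitely_generated_monoid (additive_monoid S)"
proof -
  let ?R = "monoid_algebra S :: ('m \<Rightarrow>\<^sub>0 'k) ring"
  obtain F where F: "finite F" "F \<subseteq> carrier ?R"
    "generate_ring ?R (range (Poly_Mapping.single 0) \<union> F) = carrier ?R"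
    using fg unfolding finitely_generated_algebra_def by blast
  define G where "G = (\<Union>f\<in>F. Poly_Mapping.keys f)"
  have "S \<subseteq> T" if T: "submonoid T (additive_monoid S)" "G \<subseteq> T" for T
  proof
    fix s assume s: "s \<in> S"
    have TS: "T \<subseteq> S" and T': "submonoid T (additive_monoid UNIV)"
      using T by (auto simp: submonoid_additive_iff)
    have "Poly_Mapping.keys f \<subseteq> T"
      if "f \<in> generate_ring ?R (range (Poly_Mapping.single 0) \<union> F)" for f
      using that
    proof induction
      case one
      show ?case
        using T' by (simp add: submonoid_additive_iff flip: single_one)
    next
      case (incl h)
      then show ?case
        using T' T(2) by (auto simp: submonoid_additive_iff G_def split: if_splits)
    next
      case (a_inv h)
      then show ?case
        using TS by (subst a_inv_monoid_algebra [OF S]) auto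
    next
      case (eng_add f g)
      then show ?case
        using keys_add [of f g] by auto
    next
      case (eng_mult f g)
      have add: "\<And>x y. x \<in> T \<Longrightarrow> y \<in> T \<Longrightarrow> x + y \<in> T"
        using T' by (simp add: submonoid_additive_iff)
      show ?case
        using keys_mult [of f g] eng_mult.IH by (auto intro!: add)
    qed
    from this [of "Poly_Mapping.single s 1"] show "s \<in> T"
      unfolding F(3) using s by simp
  qed
  moreover have "submonoid S (additive_monoid S)"
    using S by (auto simp: submonoid_additive_iff)
  moreover have "finite G" "G \<subseteq> S"
    using F by (auto simp: G_def)
  ultimately show ?thesis
    unfolding finitely_generated_monoid_def hull_def
    by (intro exI [of _ G]) (auto simp: additive_monoid_def)
qed

text \<open>The exponents whose monomials lie in the generated subalgebra form a submonoid
  containing \<open>G\<close>, hence all of \<open>S\<close>. Constants and sums then give every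
  element.\<close>

lemma finitely_generated_monoid_imp_algebra:
  fixes S :: "'m::ab_group_add set"
  assumes S: "submonoid S (additive_monoid UNIV)"
    and fg: "finitely_generated_monoid (additive_monoid S)"
  shows "finitely_generated_algebra (range (Poly_Mapping.single 0))
      (monoid_algebra S :: ('m \<Rightarrow>\<^sub>0 'k::field) ring)"
proof -
  let ?R = "monoid_algebra S :: ('m \<Rightarrow>\<^sub>0 'k) ring"
  interpret R: cring ?R
    by (rule cring_monoid_algebra [OF S])
  obtain G where G: "finite G" "G \<subseteq> S"
    "(\<lambda>T. submonoid T (additive_monoid S)) hull G = S"
    using fg unfolding finitely_generated_monoid_def by (auto simp: additive_monoid_def)
  let ?X = "\<lambda>m. Poly_Mapping.single m (1::'k)"
  let ?H = "range (Poly_Mapping.single 0) \<union> ?X ` G"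
  let ?A = "generate_ring ?R ?H"
  have H: "?H \<subseteq> carrier ?R"
    using S G by (auto simp: submonoid_additive_iff split: if_splits)
  define T where "T = {s \<in> S. ?X s \<in> ?A}"
  have "?X (s + s') \<in> ?A" if "?X s \<in> ?A" "?X s' \<in> ?A" for s s'
    using generate_ring.eng_mult [OF that] by (simp add: mult_single)
  moreover have "?X 0 \<in> ?A"
    using generate_ring.one [of ?R ?H] by simp
  ultimately have "submonoid T (additive_monoid S)"
    using S by (auto simp: submonoid_additive_iff T_def)
  moreover have "G \<subseteq> T"
    using G(2) by (auto simp: T_def intro!: generate_ring.incl)
  ultimately have "S \<subseteq> T"
    using hull_minimal [of G T "\<lambda>T. submonoid T (additive_monoid S)"] G(3) by simp
  then have X: "?X s \<in> ?A" if "s \<in> S" for s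
    using that by (auto simp: T_def)
  have mono: "Poly_Mapping.single s a \<in> ?A" if "s \<in> S" for s a
  proof -
    have "Poly_Mapping.single 0 a \<in> ?A"
      by (intro generate_ring.incl) simp
    from generate_ring.eng_mult [OF this X [OF that]] show ?thesis
      by (simp add: mult_single)
  qed
  have zero: "0 \<in> ?A"
    using R.zero_in_generate by simp
  have "f \<in> ?A" if "Poly_Mapping.keys f \<subseteq> S" for f
    using that
  proof (induction f rule: update_induct)
    case const
    show ?case
      by (rule zero)
  next
    case (update f t c)
    \<comment> \<open>Since \<open>t\<close> is not yet a key of \<open>f\<close>, the update adds a
      monomial and overwrites no coefficient.\<close>
    have "Poly_Mapping.update t c f = f + Poly_Mapping.single t c"
      using update(1)
      by (intro poly_mapping_eqI) (auto simp: lookup_update lookup_add lookup_single in_keys_iff)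
    moreover have "t \<in> S" "Poly_Mapping.keys f \<subseteq> S"
      using update(1,2,4) by (auto simp: subset_iff in_keys_iff lookup_update split: if_splits)
    then have "f \<in> ?A" "Poly_Mapping.single t c \<in> ?A"
      using update(3) mono by auto
    ultimately show ?case
      using generate_ring.eng_add [of f ?R ?H] by simp
  qed
  then have "?A = carrier ?R"
    using R.generate_ring_incl [OF H] by auto
  then show ?thesis
    using G(1) H unfolding finitely_generated_algebra_def
    by (intro exI [of _ "?X ` G"]) auto
qed

theorem mainTheorem1:
  fixes S :: "'m::ab_group_add set"
    and R :: "('m \<Rightarrow>\<^sub>0 'k::field) ring"
  assumes "CHAR('k) > 0"
    and "free_abelian_finite_rank (additive_monoid (UNIV :: 'm set))"
    and "submonoid S (additive_monoid UNIV)"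
    and "R = monoid_algebra S"
  shows "(split_F_regular R \<longrightarrow> finitely_generated_algebra (range (Poly_Mapping.single 0)) R) \<and>
    (finitely_generated_algebra (range (Poly_Mapping.single 0)) R \<longleftrightarrow>
     finitely_generated_monoid (additive_monoid S))"
proof -
  have "finitely_generated_algebra (range (Poly_Mapping.single 0)) R \<longleftrightarrow>
      finitely_generated_monoid (additive_monoid S)"
    unfolding assms(4)
    using finitely_generated_algebra_imp_monoid [OF assms(3)]
      finitely_generated_monoid_imp_algebra [OF assms(3)] by blast
  moreover have "finitely_generated_monoid (additive_monoid S)" if "split_F_regular R"
  proof -
    obtain B where "finite B" "B \<subseteq> S" "int_scale.span B = int_scale.span S"
      using difference_group_finitely_spanned [OF assms(2)] by blast
    moreover have "asymptotically_closed S"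
      using split_F_regular_imp_asymptotically_closed [OF assms(3)] that assms(4) by blast
    ultimately show ?thesis
      using asymptotically_closed_imp_finitely_generated [OF assms(3)] by blast
  qed
  ultimately show ?thesis
    by blast
qed

end
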